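(* Consider a two-armed Bernoulli bandit with means $0<\mu_2<\mu_1<1$. For every integer $T\ge1$, the MED policy satisfies, almost surely, $$\mathrm{SliReg}(\mathrm{MED};T)=\mu_1-\mu_2 .$$
   Context: Two-armed Bernoulli bandit: at each time $t\ge1$ the policy picks an arm $A_t\in\{1,2\}$ (possibly with internal randomization) from the history $(A_1,R_1,\dots,A_{t-1},R_{t-1})$, then observes $R_t\in\{0,1\}$ which, given $A_t$, is Bernoulli with mean $\mu_{A_t}$, independent of the past and of the policy's internal randomness. $N_a(t):=\sum_{i=1}^{t-1}\mathbf 1(A_i=a)$; $\hat\mu_a(t)$ is the empirical mean of the $N_a(t)$ rewards received from arm $a$ before time $t$; $\hat\mu^*(t):=\max_a\hat\mu_a(t)$; $\mathrm{kl}(p,q):=p\log\frac pq+(1-p)\log\frac{1-p}{1-q}$ (with values in $[0,\infty]$ and the usual conventions). MED: each arm is pulled once initially; afterwards, at time $t$, arm $a$ is sampled with probability proportional to $\exp\left(-N_a(t)\,\mathrm{kl}(\hat\mu_a(t),\hat\mu^*(t))\right)$, with $\exp(-\infty)=0$. The sliding regret is the random variable $\mathrm{SliReg}(\pi;T):=\limsup_{t\to\infty}\left(T\mu_1-\sum_{i=1}^{T}\mu_{A_{t+i}}\right)$. *)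

theory Defs
  imports "HOL-Probability.Probability"
begin

datatype arm = Arm1 | Arm2

lemma UNIV_arm: "UNIV = {Arm1, Arm2}"
  using arm.exhaust by auto

text \<open>A history lists the past (arm, reward) pairs, oldest first; the reward \<open>True\<close> encodes 1
  and \<open>False\<close> encodes 0. A policy maps a history to the distribution of the next arm; drawing the
  arm from that distribution is the policy's internal randomization.\<close>

type_synonym history = "(arm \<times> bool) list"

type_synonym policy = "history \<Rightarrow> arm pmf"

text \<open>Rounds are numbered from 1, so \<open>A 0\<close> and \<open>R 0\<close> play no role.\<close>

definition hist :: "(nat \<Rightarrow> 'w \<Rightarrow> arm) \<Rightarrow> (nat \<Rightarrow> 'w \<Rightarrow> bool) \<Rightarrow> nat \<Rightarrow> 'w \<Rightarrow> history" where
  "hist A R t \<omega> = map (\<lambda>i. (A i \<omega>, R i \<omega>)) [1..<t]"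

text \<open>Histories range over a countable type, so elementary conditional probabilities determine the
  joint law of arms and rewards. The assumption \<open>reward\<close> contains both that the reward is Bernoulli
  given the arm and that, given the arm, it does not depend on the past.\<close>

locale bandit_process = prob_space M
  for M :: "'w measure" +
  fixes \<mu> :: "arm \<Rightarrow> real"
    and \<pi> :: policy
    and A :: "nat \<Rightarrow> 'w \<Rightarrow> arm"
    and R :: "nat \<Rightarrow> 'w \<Rightarrow> bool"
  assumes measurable_arm: "\<And>t. t \<ge> 1 \<Longrightarrow> A t \<in> measurable M (count_space UNIV)"
    and measurable_reward: "\<And>t. t \<ge> 1 \<Longrightarrow> R t \<in> measurable M (count_space UNIV)"
    and arm_choice: "\<And>t h a. t \<ge> 1 \<Longrightarrow> \<P>(\<omega> in M. hist A R t \<omega> = h) > 0 \<Longrightarrow>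
      \<P>(\<omega> in M. A t \<omega> = a \<bar> hist A R t \<omega> = h) = pmf (\<pi> h) a"
    and reward: "\<And>t h a r. t \<ge> 1 \<Longrightarrow> \<P>(\<omega> in M. hist A R t \<omega> = h \<and> A t \<omega> = a) > 0 \<Longrightarrow>
      \<P>(\<omega> in M. R t \<omega> = r \<bar> hist A R t \<omega> = h \<and> A t \<omega> = a) = pmf (bernoulli_pmf (\<mu> a)) r"

definition num_pulls :: "arm \<Rightarrow> history \<Rightarrow> nat" where
  "num_pulls a h = length (filter (\<lambda>x. fst x = a) h)"

definition emp_mean :: "arm \<Rightarrow> history \<Rightarrow> real" where
  "emp_mean a h = (\<Sum>x\<leftarrow>filter (\<lambda>x. fst x = a) h. of_bool (snd x)) / real (num_pulls a h)"

definition best_emp_mean :: "history \<Rightarrow> real" where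
  "best_emp_mean h = max (emp_mean Arm1 h) (emp_mean Arm2 h)"

text \<open>The summand \<open>p log (p/q)\<close> with the conventions \<open>0 log (0/q) = 0\<close> (also for \<open>q = 0\<close>) and
  \<open>p log (p/0) = \<infinity>\<close> for \<open>p > 0\<close>.\<close>

definition kl_term :: "real \<Rightarrow> real \<Rightarrow> ereal" where
  "kl_term p q = (if p = 0 then 0 else if q = 0 then \<infinity> else ereal (p * ln (p / q)))"

definition kl :: "real \<Rightarrow> real \<Rightarrow> ereal" where
  "kl p q = kl_term p q + kl_term (1 - p) (1 - q)"

text \<open>\<open>exp (- x)\<close> for \<open>x > -\<infinity>\<close>, with \<open>exp (- \<infinity>) = 0\<close>.\<close>

definition exp_neg :: "ereal \<Rightarrow> real" where
  "exp_neg x = (if x = \<infinity> then 0 else exp (- real_of_ereal x))"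

definition med_weight :: "arm \<Rightarrow> history \<Rightarrow> real" where
  "med_weight a h = exp_neg (ereal (real (num_pulls a h)) * kl (emp_mean a h) (best_emp_mean h))"

text \<open>The order of the two initial pulls is left open: the first arm has distribution \<open>q\<close>, and the
  second round pulls the other arm.\<close>

definition med :: "arm pmf \<Rightarrow> policy" where
  "med q h =
    (if h = [] then q
     else if \<exists>a. num_pulls a h = 0 then return_pmf (THE a. num_pulls a h = 0)
     else embed_pmf (\<lambda>a. med_weight a h / (\<Sum>b\<in>UNIV. med_weight b h)))"

lemma exp_neg_nonneg: "exp_neg x \<ge> 0"
  by (simp add: exp_neg_def)

lemma kl_self: "kl p p = 0"
  by (simp add: kl_def kl_term_def)

lemma sum_med_weight_pos: "(\<Sum>b\<in>UNIV. med_weight b h) > 0"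
proof -
  have *: "med_weight a h = 1" if "emp_mean a h = best_emp_mean h" for a
    using that by (simp add: med_weight_def kl_self exp_neg_def)
  have "emp_mean Arm1 h = best_emp_mean h \<or> emp_mean Arm2 h = best_emp_mean h"
    by (simp add: best_emp_mean_def max_def)
  then have "med_weight Arm1 h = 1 \<or> med_weight Arm2 h = 1"
    using * by blast
  moreover have "med_weight a h \<ge> 0" for a
    by (simp add: med_weight_def exp_neg_nonneg)
  ultimately show ?thesis
    by (auto simp: UNIV_arm intro: add_pos_nonneg add_nonneg_pos)
qed

lemma pmf_med:
  assumes "num_pulls Arm1 h > 0" "num_pulls Arm2 h > 0"
  shows "pmf (med q h) a = med_weight a h / (\<Sum>b\<in>UNIV. med_weight b h)"
proof -
  let ?f = "\<lambda>a. med_weight a h / (\<Sum>b\<in>UNIV. med_weight b h)"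
  have pos: "num_pulls b h > 0" for b
    using assms by (cases b) auto
  then have "h \<noteq> []"
    by (auto simp: num_pulls_def)
  have nonneg: "?f b \<ge> 0" for b
    using sum_med_weight_pos[of h] by (auto simp: med_weight_def exp_neg_nonneg)
  have fin: "finite (UNIV :: arm set)"
    by (simp add: UNIV_arm)
  have "(\<Sum>b\<in>UNIV. ?f b) = 1"
    using sum_med_weight_pos[of h] by (simp add: sum_divide_distrib[symmetric])
  then have "(\<integral>\<^sup>+b. ennreal (?f b) \<partial>count_space UNIV) = 1"
    by (simp only: nn_integral_count_space_finite[OF fin] sum_ennreal[OF nonneg] ennreal_1)
  then have "pmf (embed_pmf ?f) a = ?f a"
    by (rule pmf_embed_pmf[OF nonneg])
  moreover have "\<not> (\<exists>b. num_pulls b h = 0)"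
    using pos by (metis less_irrefl)
  ultimately show ?thesis
    unfolding med_def using \<open>h \<noteq> []\<close> by (simp only: if_False)
qed

text \<open>\<open>Arm1\<close> is taken to be the arm with the larger mean.\<close>

definition sliding_regret ::
    "(arm \<Rightarrow> real) \<Rightarrow> (nat \<Rightarrow> 'w \<Rightarrow> arm) \<Rightarrow> nat \<Rightarrow> 'w \<Rightarrow> ereal" where
  "sliding_regret \<mu> A T \<omega> =
    limsup (\<lambda>t. ereal (real T * \<mu> Arm1 - (\<Sum>i=1..T. \<mu> (A (t + i) \<omega>))))"

end

theory Submission
  imports Defs
begin

text \<open>Almost sure statements come from one Borel--Cantelli lemma for histories with a nonnegative
  potential. An exponential potential shows that the empirical mean of an arm that is pulled
  infinitely often converges. An arm that is no longer pulled keeps a fixed number \<open>n\<close> of pulls,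
  while the empirical mean of the other arm stays below some \<open>c < 1\<close>; its sampling probability is
  then at least \<open>(1 - c)\<^sup>n / 2\<close>, so it is pulled again. Hence both arms are pulled infinitely
  often, and every window that contains a pull of arm 2 has regret at least \<open>\<mu>\<^sub>1 - \<mu>\<^sub>2\<close>. Once the
  empirical means are accurate, arm 2 is sampled with probability at most \<open>exp (- c N)\<close> after \<open>N\<close>
  pulls. The chance that the \<open>N\<close>-th pull is followed by another one within \<open>T\<close> rounds is thus
  at most \<open>T exp (- c N)\<close>, which is summable over \<open>N\<close>, so eventually no window contains two pulls
  of arm 2.\<close>

section \<open>Finite sums over histories and one-step expectations\<close>

lemma hist_Suc:
  "t \<ge> 1 \<Longrightarrow> hist A R (Suc t) \<omega> = hist A R t \<omega> @ [(A t \<omega>, R t \<omega>)]"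
  by (simp add: hist_def)

lemma length_hist: "length (hist A R (Suc n) \<omega>) = n"
  by (simp add: hist_def)

lemma finite_UNIV_arm: "finite (UNIV :: arm set)"
  by (simp add: UNIV_arm)

lemma finite_histories: "finite {h :: history. length h = n}"
proof -
  have "finite (UNIV :: (arm \<times> bool) set)"
    using finite_UNIV_arm by (simp add: finite_prod)
  then show ?thesis
    using finite_lists_length_eq[of UNIV n] by simp
qed

lemma sum_histories_Suc:
  fixes f :: "history \<Rightarrow> real"
  shows "(\<Sum>h | length h = Suc n. f h) =
    (\<Sum>h | length h = n. \<Sum>a\<in>UNIV. \<Sum>r\<in>UNIV. f (h @ [(a, r)]))"
proof -
  have "(\<Sum>h | length h = Suc n. f h) = (\<Sum>(h, x)\<in>{h. length h = n} \<times> UNIV. f (h @ [x]))"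
  proof (rule sum.reindex_bij_witness[of _ "\<lambda>(h, x). h @ [x]" "\<lambda>h. (butlast h, last h)"])
    fix h :: history
    assume "h \<in> {h. length h = Suc n}"
    then have "h \<noteq> []" "length h = Suc n" by auto
    then show "(case (butlast h, last h) of (h, x) \<Rightarrow> h @ [x]) = h"
      and "(butlast h, last h) \<in> {h. length h = n} \<times> UNIV"
      and "(case (butlast h, last h) of (h, x) \<Rightarrow> f (h @ [x])) = f h"
      by simp_all
  next
    fix y :: "history \<times> arm \<times> bool"
    assume "y \<in> {h. length h = n} \<times> UNIV"
    then show "(butlast (case y of (h, x) \<Rightarrow> h @ [x]), last (case y of (h, x) \<Rightarrow> h @ [x])) = y"
      and "(case y of (h, x) \<Rightarrow> h @ [x]) \<in> {h. length h = Suc n}"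
      by (cases y; simp)+
  qed
  also have "\<dots> = (\<Sum>h | length h = n. \<Sum>x\<in>UNIV. f (h @ [x]))"
    by (rule sum.cartesian_product[symmetric])
  also have "\<dots> = (\<Sum>h | length h = n. \<Sum>a\<in>UNIV. \<Sum>r\<in>UNIV. f (h @ [(a, r)]))"
    unfolding sum.cartesian_product UNIV_Times_UNIV by (simp add: case_prod_beta)
  finally show ?thesis .
qed

text \<open>The transition operator of the Markov chain of histories, that is, the conditional
  expectation of \<open>f\<close> after one more round.\<close>

definition expected_next :: "(arm \<Rightarrow> real) \<Rightarrow> policy \<Rightarrow> (history \<Rightarrow> real) \<Rightarrow> history \<Rightarrow> real" where
  "expected_next \<mu> \<pi> f h = (\<Sum>a\<in>UNIV. pmf (\<pi> h) a *
    (\<Sum>r\<in>UNIV. pmf (bernoulli_pmf (\<mu> a)) r * f (h @ [(a, r)])))"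

lemma sum_pmf_arm: "(\<Sum>a\<in>UNIV. pmf p a) = 1" for p :: "arm pmf"
  by (rule sum_pmf_eq_1) (auto simp: finite_UNIV_arm)

lemma sum_pmf_bool: "(\<Sum>r\<in>UNIV. pmf p r) = 1" for p :: "bool pmf"
  by (rule sum_pmf_eq_1) auto

lemma sum_pmf_bool_mult: "(\<Sum>r\<in>UNIV. pmf p r * c) = c" for p :: "bool pmf"
  by (simp only: sum_distrib_right[symmetric] sum_pmf_bool mult_1)

text \<open>Used for every drift estimate below: each potential needs special treatment only when
  one arm \<open>a\<close> is pulled. The estimate then reduces to a pointwise bound and a mean over
  the reward of that single arm.\<close>

lemma expected_next_le:
  assumes "\<And>b r. f (h @ [(b, r)]) \<le> y + (if b = a then k r else 0)"
    and "(\<Sum>r\<in>UNIV. pmf (bernoulli_pmf (\<mu> a)) r * k r) \<le> c"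
  shows "expected_next \<mu> \<pi> f h \<le> y + pmf (\<pi> h) a * c"
proof -
  have "expected_next \<mu> \<pi> f h \<le> (\<Sum>b\<in>UNIV. pmf (\<pi> h) b * (y + (if b = a then c else 0)))"
    unfolding expected_next_def
  proof (intro sum_mono mult_left_mono)
    fix b
    have "(\<Sum>r\<in>UNIV. pmf (bernoulli_pmf (\<mu> b)) r * f (h @ [(b, r)]))
        \<le> (\<Sum>r\<in>UNIV. pmf (bernoulli_pmf (\<mu> b)) r * (y + (if b = a then k r else 0)))"
      by (intro sum_mono mult_left_mono assms(1)) auto
    also have "\<dots> = y + (\<Sum>r\<in>UNIV. pmf (bernoulli_pmf (\<mu> b)) r * (if b = a then k r else 0))"
      by (simp only: distrib_left sum.distrib sum_distrib_right[symmetric] sum_pmf_bool mult_1)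
    also have "\<dots> \<le> y + (if b = a then c else 0)"
      using assms(2) by simp
    finally show "(\<Sum>r\<in>UNIV. pmf (bernoulli_pmf (\<mu> b)) r * f (h @ [(b, r)]))
        \<le> y + (if b = a then c else 0)" .
  qed auto
  also have "\<dots> = (\<Sum>b\<in>UNIV. pmf (\<pi> h) b) * y + (\<Sum>b\<in>UNIV. pmf (\<pi> h) b * (if b = a then c else 0))"
    by (simp only: distrib_left sum.distrib sum_distrib_right)
  also have "\<dots> = y + pmf (\<pi> h) a * c"
    by (simp add: sum_pmf_arm finite_UNIV_arm if_distrib cong: if_cong)
  finally show ?thesis .
qed

section \<open>The law of the history and Borel--Cantelli\<close>

context bandit_process
begin

lemma sets_hist_eq: "{\<omega> \<in> space M. hist A R (Suc n) \<omega> = h} \<in> events"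
proof (induction n arbitrary: h)
  case 0
  have "{\<omega> \<in> space M. hist A R (Suc 0) \<omega> = h} = (if h = [] then space M else {})"
    by (simp add: hist_def)
  then show ?case by simp
next
  case (Suc n)
  show ?case
  proof (cases h rule: rev_cases)
    case Nil
    then have "{\<omega> \<in> space M. hist A R (Suc (Suc n)) \<omega> = h} = {}"
      using hist_Suc[of "Suc n" A R] by simp
    then show ?thesis by (simp only: sets.empty_sets)
  next
    case (snoc h' x)
    have eq: "hist A R (Suc (Suc n)) \<omega> = h \<longleftrightarrow>
        hist A R (Suc n) \<omega> = h' \<and> A (Suc n) \<omega> = fst x \<and> R (Suc n) \<omega> = snd x" for \<omega>
      unfolding snoc by (subst hist_Suc, simp) (cases x, simp)
    have split: "{\<omega> \<in> space M. hist A R (Suc (Suc n)) \<omega> = h} =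
        {\<omega> \<in> space M. hist A R (Suc n) \<omega> = h'} \<inter>
        ((A (Suc n) -` {fst x} \<inter> space M) \<inter> (R (Suc n) -` {snd x} \<inter> space M))"
      unfolding eq by blast
    show ?thesis
      unfolding split
    proof (rule sets.Int[OF Suc sets.Int])
      show "A (Suc n) -` {fst x} \<inter> space M \<in> events"
        by (rule measurable_sets[OF measurable_arm]) simp_all
      show "R (Suc n) -` {snd x} \<inter> space M \<in> events"
        by (rule measurable_sets[OF measurable_reward]) simp_all
    qed
  qed
qed

lemma hist_in_eq_UN:
  "{\<omega> \<in> space M. hist A R (Suc n) \<omega> \<in> S} =
    (\<Union>h\<in>{h. length h = n} \<inter> S. {\<omega> \<in> space M. hist A R (Suc n) \<omega> = h})" (is "?L = ?R")
proof (rule set_eqI)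
  fix \<omega>
  show "\<omega> \<in> ?L \<longleftrightarrow> \<omega> \<in> ?R"
    using length_hist[of A R n \<omega>] by simp
qed

lemma sets_hist: "{\<omega> \<in> space M. hist A R (Suc n) \<omega> \<in> S} \<in> events"
proof (subst hist_in_eq_UN, rule sets.finite_UN)
  show "finite ({h. length h = n} \<inter> S)"
    using finite_histories by blast
  fix h
  show "{\<omega> \<in> space M. hist A R (Suc n) \<omega> = h} \<in> events"
    by (rule sets_hist_eq)
qed

lemma prob_hist_snoc:
  "\<P>(\<omega> in M. hist A R (Suc (Suc n)) \<omega> = h @ [(a, r)]) =
    \<P>(\<omega> in M. hist A R (Suc n) \<omega> = h) * (pmf (\<pi> h) a * pmf (bernoulli_pmf (\<mu> a)) r)"
proof -
  let ?t = "Suc n"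
  let ?H = "{\<omega> \<in> space M. hist A R ?t \<omega> = h}"
  let ?HA = "{\<omega> \<in> space M. hist A R ?t \<omega> = h \<and> A ?t \<omega> = a}"
  let ?HAR = "{\<omega> \<in> space M. hist A R ?t \<omega> = h \<and> A ?t \<omega> = a \<and> R ?t \<omega> = r}"
  have H: "?H \<in> events" by (rule sets_hist_eq)
  have HA: "?HA \<in> events"
  proof -
    have "?HA = ?H \<inter> (A ?t -` {a} \<inter> space M)" by blast
    moreover have "A ?t -` {a} \<inter> space M \<in> events"
      by (rule measurable_sets[OF measurable_arm]) simp_all
    ultimately show ?thesis using H by (metis sets.Int)
  qed
  \<comment> \<open>The locale assumptions concern only conditioning events of positive probability;
    for null events both sides vanish.\<close>
  have 1: "prob ?HA = prob ?H * pmf (\<pi> h) a"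
  proof (cases "prob ?H = 0")
    case True
    moreover have "prob ?HA \<le> prob ?H" by (rule finite_measure_mono[OF _ H]) auto
    ultimately show ?thesis by (simp add: measure_le_0_iff)
  next
    case False
    then have "prob ?H > 0" by (simp add: zero_less_measure_iff)
    with arm_choice[of ?t h a] False show ?thesis
      by (simp add: cond_prob_def field_simps conj_commute)
  qed
  have 2: "prob ?HAR = prob ?HA * pmf (bernoulli_pmf (\<mu> a)) r"
  proof (cases "prob ?HA = 0")
    case True
    moreover have "prob ?HAR \<le> prob ?HA" by (rule finite_measure_mono[OF _ HA]) auto
    ultimately show ?thesis by (simp add: measure_le_0_iff)
  next
    case False
    then have pos: "prob ?HA > 0" by (simp add: zero_less_measure_iff)
    have "{\<omega> \<in> space M. R ?t \<omega> = r \<and> hist A R ?t \<omega> = h \<and> A ?t \<omega> = a} = ?HAR" by auto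
    with reward[of ?t h a r] pos False show ?thesis
      by (simp add: cond_prob_def field_simps)
  qed
  have "{\<omega> \<in> space M. hist A R (Suc ?t) \<omega> = h @ [(a, r)]} = ?HAR"
    by (subst hist_Suc, simp) simp
  with 1 2 show ?thesis by simp
qed

text \<open>The expectation of \<open>f\<close> at the history of the first \<open>n\<close> rounds,
  which is the history available in round \<open>Suc n\<close>. There are finitely many such
  histories, so a finite sum replaces the integral.\<close>

definition expected_hist :: "(history \<Rightarrow> real) \<Rightarrow> nat \<Rightarrow> real" where
  "expected_hist f n = (\<Sum>h | length h = n. \<P>(\<omega> in M. hist A R (Suc n) \<omega> = h) * f h)"

lemma expected_hist_Suc: "expected_hist f (Suc n) = expected_hist (expected_next \<mu> \<pi> f) n"
  unfolding expected_hist_def sum_histories_Suc prob_hist_snoc expected_next_def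
  by (simp only: sum_distrib_left mult.assoc)

lemma expected_hist_mono: "(\<And>h. f h \<le> g h) \<Longrightarrow> expected_hist f n \<le> expected_hist g n"
  unfolding expected_hist_def by (intro sum_mono mult_left_mono) auto

lemma expected_hist_add: "expected_hist (\<lambda>h. f h + g h) n = expected_hist f n + expected_hist g n"
  unfolding expected_hist_def by (simp add: distrib_left sum.distrib)

lemma prob_hist_in: "\<P>(\<omega> in M. hist A R (Suc n) \<omega> \<in> S) = expected_hist (indicator S) n"
proof -
  have fin: "finite ({h. length h = n} \<inter> S)"
    by (rule finite_Int[OF disjI1[OF finite_histories]])
  have "\<P>(\<omega> in M. hist A R (Suc n) \<omega> \<in> S) =
      (\<Sum>h\<in>{h. length h = n} \<inter> S. \<P>(\<omega> in M. hist A R (Suc n) \<omega> = h))"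
    unfolding hist_in_eq_UN
  proof (rule finite_measure_finite_Union[OF fin])
    show "(\<lambda>h. {\<omega> \<in> space M. hist A R (Suc n) \<omega> = h}) ` ({h. length h = n} \<inter> S) \<subseteq> events"
      using sets_hist_eq by (rule image_subsetI)
    show "disjoint_family_on (\<lambda>h. {\<omega> \<in> space M. hist A R (Suc n) \<omega> = h}) ({h. length h = n} \<inter> S)"
      unfolding disjoint_family_on_def by blast
  qed
  also have "\<dots> = expected_hist (indicator S) n"
    unfolding expected_hist_def indicator_def
    using finite_histories by (simp add: sum.inter_restrict if_distrib cong: if_cong)
  finally show ?thesis .
qed

text \<open>Borel--Cantelli for histories: each visit to \<open>S\<close> is paid for by a decrease of the
  potential \<open>V\<close> in expectation, so the expected number of visits is at most \<open>V []\<close>.\<close>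

lemma eventually_hist_notin:
  assumes nonneg: "\<And>h. V h \<ge> 0"
    and drift: "\<And>h. expected_next \<mu> \<pi> (\<lambda>h. V h + indicator S h) h \<le> V h"
  shows "AE \<omega> in M. \<forall>\<^sub>F t in sequentially. hist A R (Suc t) \<omega> \<notin> S"
proof -
  have step: "expected_hist V (Suc n) + expected_hist (indicator S) (Suc n) \<le> expected_hist V n" for n
    unfolding expected_hist_add[symmetric] unfolding expected_hist_Suc
    by (rule expected_hist_mono) (rule drift)
  \<comment> \<open>The drift inequality telescopes. As the remaining potential is nonnegative, the
    probabilities of visiting \<open>S\<close> have bounded partial sums.\<close>
  have sum: "(\<Sum>i<n. expected_hist (indicator S) (Suc i)) + expected_hist V n
      \<le> expected_hist V 0" for n
  proof (induction n)
    case (Suc n)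
    then show ?case using step[of n] by simp
  qed simp
  have "expected_hist V n \<ge> 0" for n
    unfolding expected_hist_def using nonneg by (intro sum_nonneg mult_nonneg_nonneg) auto
  then have "(\<Sum>i<n. expected_hist (indicator S) (Suc i)) \<le> expected_hist V 0" for n
    using sum[of n] by (meson add_increasing2 order_trans order_refl)
  moreover have "expected_hist (indicator S) n \<ge> 0" for n
    unfolding prob_hist_in[symmetric] by simp
  ultimately have "summable (\<lambda>n. expected_hist (indicator S) (Suc n))"
    by (intro summableI_nonneg_bounded) auto
  then have "summable (\<lambda>n. \<P>(\<omega> in M. hist A R (Suc n) \<omega> \<in> S))"
    unfolding prob_hist_in by (subst (asm) summable_Suc_iff)
  then have "AE \<omega> in M. \<forall>\<^sub>F t in sequentially.
      \<omega> \<in> space M - {\<omega> \<in> space M. hist A R (Suc t) \<omega> \<in> S}"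
    by (intro borel_cantelli_AE1 sets_hist) (simp_all add: less_top[symmetric])
  then show ?thesis
  proof eventually_elim
    case (elim \<omega>)
    then show ?case by (rule eventually_mono) auto
  qed
qed

end

section \<open>Bounds on \<open>kl\<close> and on the sampling probabilities of MED\<close>

text \<open>These two bounds compare \<open>kl\<close> with the squared Hellinger distance, using
  \<open>ln x \<le> x - 1\<close> at \<open>x = sqrt (q / p)\<close>.\<close>

lemma kl_term_ge:
  assumes "0 \<le> p" "0 \<le> q"
  shows "ereal (2 * p - 2 * sqrt (p * q)) \<le> kl_term p q"
proof (cases "p = 0 \<or> q = 0")
  case True
  then show ?thesis by (auto simp: kl_term_def)
next
  case False
  with assms have pos: "p > 0" "q > 0" by auto
  have "ln (sqrt (q / p)) \<le> sqrt (q / p) - 1"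
    using pos by (intro ln_le_minus_one) simp
  moreover have "ln (sqrt (q / p)) = - ln (p / q) / 2"
    using pos by (simp add: ln_sqrt ln_div)
  ultimately have "p * ln (p / q) \<ge> p * (2 - 2 * sqrt (q / p))"
    using pos by (intro mult_left_mono) auto
  moreover have "p * sqrt (q / p) = sqrt (p * q)"
  proof -
    have "sqrt (p * q) = sqrt (p\<^sup>2 * (q / p))"
      using pos by (simp add: power2_eq_square)
    also have "\<dots> = p * sqrt (q / p)"
      using pos by (subst real_sqrt_mult) simp
    finally show ?thesis by simp
  qed
  ultimately have "2 * p - 2 * sqrt (p * q) \<le> p * ln (p / q)"
    by (simp add: algebra_simps)
  then show ?thesis
    using False by (simp add: kl_term_def)
qed

lemma kl_ge:
  assumes "0 \<le> p" "p \<le> 1" "0 \<le> q" "q \<le> 1"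
  shows "ereal ((q - p)\<^sup>2 / 4) \<le> kl p q"
proof -
  define a b where "a = sqrt p" and "b = sqrt q"
  define a' b' where "a' = sqrt (1 - p)" and "b' = sqrt (1 - q)"
  have sq: "a\<^sup>2 = p" "b\<^sup>2 = q" "a'\<^sup>2 = 1 - p" "b'\<^sup>2 = 1 - q"
    and ab: "0 \<le> a" "a \<le> 1" "0 \<le> b" "b \<le> 1"
    using assms by (simp_all add: a_def b_def a'_def b'_def)
  have "(q - p)\<^sup>2 = (b - a)\<^sup>2 * (b + a)\<^sup>2"
    unfolding power_mult_distrib[symmetric] sq[symmetric]
    by (simp add: algebra_simps power2_eq_square)
  also have "\<dots> \<le> (b - a)\<^sup>2 * 2\<^sup>2"
    using ab by (intro mult_left_mono power_mono) auto
  finally have "(q - p)\<^sup>2 / 4 \<le> (b - a)\<^sup>2" by simp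
  also have "\<dots> \<le> (b - a)\<^sup>2 + (b' - a')\<^sup>2" by simp
  \<comment> \<open>Both sides are \<open>2 - 2 * a * b - 2 * a' * b'\<close>, because the four
    squares sum to 2.\<close>
  also have "\<dots> = (2 * p - 2 * sqrt (p * q)) + (2 * (1 - p) - 2 * sqrt ((1 - p) * (1 - q)))"
    using sq by (simp add: power2_diff real_sqrt_mult flip: a_def b_def a'_def b'_def)
  finally have "ereal ((q - p)\<^sup>2 / 4) \<le>
      ereal (2 * p - 2 * sqrt (p * q)) + ereal (2 * (1 - p) - 2 * sqrt ((1 - p) * (1 - q)))"
    by simp
  also have "\<dots> \<le> kl p q"
    unfolding kl_def using assms by (intro add_mono kl_term_ge) auto
  finally show ?thesis .
qed

text \<open>For \<open>p \<le> q\<close> the first summand is nonpositive. In the second,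
  \<open>ln (1 - p) \<le> 0\<close> and \<open>1 - p \<le> 1\<close> leave at most
  \<open>- ln (1 - q)\<close>.\<close>

lemma kl_le:
  assumes "0 \<le> p" "p \<le> q" "q < 1"
  shows "kl p q \<le> ereal (- ln (1 - q))"
proof -
  have "kl_term p q \<le> ereal 0"
  proof (cases "p = 0")
    case False
    with assms have "p * ln (p / q) \<le> 0"
      by (intro mult_nonneg_nonpos) (auto simp: ln_le_zero_iff)
    then show ?thesis using assms by (auto simp: kl_term_def)
  qed (simp add: kl_term_def)
  moreover have "kl_term (1 - p) (1 - q) \<le> ereal (- ln (1 - q))"
  proof -
    have "(1 - p) * ln ((1 - p) / (1 - q)) = (1 - p) * (ln (1 - p) - ln (1 - q))"
      using assms by (simp add: ln_div)
    also have "\<dots> \<le> (1 - p) * (- ln (1 - q))"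
      using assms by (intro mult_left_mono) auto
    also have "\<dots> \<le> 1 * (- ln (1 - q))"
      using assms by (intro mult_right_mono) auto
    finally show ?thesis using assms by (simp add: kl_term_def)
  qed
  ultimately have "kl p q \<le> ereal 0 + ereal (- ln (1 - q))"
    unfolding kl_def by (rule add_mono)
  then show ?thesis by simp
qed

lemma exp_neg_le: "ereal x \<le> y \<Longrightarrow> exp_neg y \<le> exp (- x)"
  by (cases y) (auto simp: exp_neg_def)

lemma exp_neg_ge: "0 \<le> y \<Longrightarrow> y \<le> ereal x \<Longrightarrow> exp (- x) \<le> exp_neg y"
  by (cases y) (auto simp: exp_neg_def)

lemma emp_mean_nonneg: "0 \<le> emp_mean a h"
  unfolding emp_mean_def by (intro divide_nonneg_nonneg sum_list_nonneg) auto

lemma emp_mean_le_1: "emp_mean a h \<le> 1"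
proof -
  have "(\<Sum>x\<leftarrow>filter (\<lambda>x. fst x = a) h. of_bool (snd x)) \<le> real (num_pulls a h)"
    unfolding num_pulls_def
    by (rule order_trans[OF sum_list_mono[of _ _ "\<lambda>_. 1"]]) (auto simp: sum_list_triv)
  then show ?thesis
    by (auto simp: emp_mean_def divide_le_eq_1)
qed

lemma best_emp_mean_bounds: "0 \<le> best_emp_mean h" "best_emp_mean h \<le> 1"
  "emp_mean a h \<le> best_emp_mean h"
  using emp_mean_nonneg emp_mean_le_1
  by (cases a; auto simp: best_emp_mean_def max_def)+

text \<open>The quadratic bound \<open>kl_ge\<close> makes the weight decay exponentially in the
  number of pulls while the empirical gap stays away from 0.\<close>

lemma med_weight_le:
  "med_weight a h \<le> exp (- (real (num_pulls a h) * (best_emp_mean h - emp_mean a h)\<^sup>2 / 4))"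
proof -
  have "ereal (real (num_pulls a h)) * ereal ((best_emp_mean h - emp_mean a h)\<^sup>2 / 4)
      \<le> ereal (real (num_pulls a h)) * kl (emp_mean a h) (best_emp_mean h)"
    by (intro ereal_mult_left_mono kl_ge emp_mean_nonneg emp_mean_le_1 best_emp_mean_bounds) simp
  then show ?thesis
    unfolding med_weight_def by (intro exp_neg_le) simp
qed

lemma med_weight_nonneg: "0 \<le> med_weight a h"
  by (simp add: med_weight_def exp_neg_nonneg)

lemma med_weight_le_1: "med_weight a h \<le> 1"
  by (rule order_trans[OF med_weight_le]) simp

lemma med_weight_best: "emp_mean a h = best_emp_mean h \<Longrightarrow> med_weight a h = 1"
  by (simp add: med_weight_def kl_self exp_neg_def)

text \<open>Either \<open>a\<close> is empirically best and has weight 1, or the best empirical mean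
  belongs to the other arm and is at most \<open>c\<close>; then \<open>kl_le\<close> bounds the
  exponent by \<open>- n ln (1 - c)\<close>.\<close>

lemma med_weight_ge:
  assumes "\<And>b. b \<noteq> a \<Longrightarrow> emp_mean b h \<le> c" "c < 1" "0 \<le> c"
  shows "(1 - c) ^ num_pulls a h \<le> med_weight a h"
proof (cases "emp_mean a h = best_emp_mean h")
  case True
  then show ?thesis
    using assms by (simp add: med_weight_best power_le_one)
next
  case False
  let ?n = "real (num_pulls a h)"
  let ?q = "best_emp_mean h"
  have le: "?q \<le> c"
    using False assms(1) by (cases a) (auto simp: best_emp_mean_def max_def split: if_splits)
  \<comment> \<open>Needed for \<open>exp_neg_ge\<close>: it excludes minus infinity, where
    \<open>exp_neg\<close> takes the default value 1.\<close>
  have "0 \<le> kl (emp_mean a h) ?q"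
  proof -
    have "ereal 0 \<le> ereal ((?q - emp_mean a h)\<^sup>2 / 4)" by simp
    also have "\<dots> \<le> kl (emp_mean a h) ?q"
      by (intro kl_ge emp_mean_nonneg emp_mean_le_1 best_emp_mean_bounds)
    finally show ?thesis by (simp add: zero_ereal_def)
  qed
  then have "0 \<le> ereal ?n * kl (emp_mean a h) ?q" by simp
  moreover have "ereal ?n * kl (emp_mean a h) ?q \<le> ereal ?n * ereal (- ln (1 - ?q))"
    using le assms by (intro ereal_mult_left_mono kl_le emp_mean_nonneg best_emp_mean_bounds) auto
  ultimately have "exp (- (?n * (- ln (1 - ?q)))) \<le> med_weight a h"
    unfolding med_weight_def by (intro exp_neg_ge) auto
  also have "exp (- (?n * (- ln (1 - ?q)))) = (1 - ?q) ^ num_pulls a h"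
    using le assms by (simp add: exp_of_nat_mult)
  finally show ?thesis
    using le assms by (meson diff_left_mono order_trans power_mono diff_ge_0_iff_ge less_imp_le)
qed

lemma sum_med_weight_le_2: "(\<Sum>b\<in>UNIV. med_weight b h) \<le> 2"
  using med_weight_le_1[of Arm1 h] med_weight_le_1[of Arm2 h] by (simp add: UNIV_arm)

lemma pmf_med_ge:
  assumes "\<And>b. num_pulls b h > 0" "\<And>b. b \<noteq> a \<Longrightarrow> emp_mean b h \<le> c" "c < 1" "0 \<le> c"
  shows "(1 - c) ^ num_pulls a h / 2 \<le> pmf (med q h) a"
  unfolding pmf_med[OF assms(1) assms(1)]
  using med_weight_ge[OF assms(2-4)] sum_med_weight_le_2 sum_med_weight_pos med_weight_nonneg
  by (intro frac_le) auto

text \<open>Arm 1 is empirically best and has weight 1, so arm 2 with weight \<open>w\<close> is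
  sampled with probability \<open>w / (1 + w) \<le> w\<close>.\<close>

lemma pmf_med_worse_le:
  assumes "\<And>b. num_pulls b h > 0" "d \<ge> 0" "emp_mean Arm1 h - emp_mean Arm2 h \<ge> d"
  shows "pmf (med q h) Arm2 \<le> exp (- (d\<^sup>2 / 4) * real (num_pulls Arm2 h))"
proof -
  have best: "best_emp_mean h = emp_mean Arm1 h"
    using assms by (simp add: best_emp_mean_def)
  have "pmf (med q h) Arm2 = med_weight Arm2 h / (1 + med_weight Arm2 h)"
    using best by (simp add: pmf_med assms(1) UNIV_arm med_weight_best)
  also have "\<dots> \<le> med_weight Arm2 h"
    using med_weight_nonneg[of Arm2 h] by (simp add: divide_le_eq mult_left_mono add_pos_nonneg algebra_simps)
  also have "\<dots> \<le> exp (- (real (num_pulls Arm2 h) * (best_emp_mean h - emp_mean Arm2 h)\<^sup>2 / 4))"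
    by (rule med_weight_le)
  also have "\<dots> \<le> exp (- (real (num_pulls Arm2 h) * d\<^sup>2 / 4))"
    using assms best by (simp add: mult_left_mono power_mono)
  finally show ?thesis by (simp add: mult.commute)
qed

text \<open>With two arms and a nonempty history, at most one arm is unpulled, so the
  \<open>THE\<close> in \<open>med\<close> denotes \<open>a\<close>.\<close>

lemma pmf_med_unpulled:
  assumes "h \<noteq> []" "num_pulls a h = 0"
  shows "pmf (med q h) a = 1"
proof -
  have unique: "b = a" if "num_pulls b h = 0" for b
  proof -
    obtain x where "x \<in> set h" using assms(1) by (cases h) auto
    then have "fst x \<noteq> a" "fst x \<noteq> b"
      using assms(2) that by (auto simp: num_pulls_def filter_empty_conv)
    then show ?thesis by (metis arm.exhaust)
  qed
  have "(THE b. num_pulls b h = 0) = a"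
    by (rule the_equality[where P = "\<lambda>b. num_pulls b h = 0", OF assms(2) unique])
  moreover have "\<exists>b. num_pulls b h = 0"
    using assms(2) by blast
  ultimately have "med q h = return_pmf a"
    unfolding med_def using assms(1) by (simp only: if_True if_False)
  then show ?thesis
    by simp
qed

section \<open>Three potentials: deviations, avoided arms, repeated pulls\<close>

text \<open>The martingale of centred rewards, not divided by the number of pulls, so that a further
  pull only adds one term.\<close>

definition deviation :: "(arm \<Rightarrow> real) \<Rightarrow> arm \<Rightarrow> history \<Rightarrow> real" where
  "deviation \<mu> a h = (\<Sum>x\<leftarrow>filter (\<lambda>x. fst x = a) h. of_bool (snd x) - \<mu> a)"

lemma num_pulls_snoc: "num_pulls a (h @ [(b, r)]) = num_pulls a h + (if b = a then 1 else 0)"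
  by (simp add: num_pulls_def)

lemma deviation_snoc:
  "deviation \<mu> a (h @ [(b, r)]) = deviation \<mu> a h + (if b = a then of_bool r - \<mu> a else 0)"
  by (simp add: deviation_def)

lemma deviation_eq:
  assumes "num_pulls a h > 0"
  shows "deviation \<mu> a h = real (num_pulls a h) * (emp_mean a h - \<mu> a)"
proof -
  have "deviation \<mu> a h = (\<Sum>x\<leftarrow>filter (\<lambda>x. fst x = a) h. of_bool (snd x)) - real (num_pulls a h) * \<mu> a"
    unfolding deviation_def num_pulls_def by (simp add: sum_list_subtractf sum_list_triv)
  then show ?thesis
    using assms by (simp add: emp_mean_def algebra_simps)
qed

text \<open>At \<open>l = 0\<close> both sides equal 1. A centred Bernoulli variable has mean 0, so
  the difference of the two sides has derivative \<open>\<delta> > 0\<close> there and is positive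
  for small \<open>l > 0\<close>.\<close>

lemma exp_moment_less:
  fixes \<sigma> \<delta> m :: real
  assumes "\<delta> > 0"
  shows "\<exists>l>0. m * exp (l * (\<sigma> * (1 - m))) + (1 - m) * exp (l * (\<sigma> * (0 - m))) < exp (l * \<delta>)"
proof -
  let ?f = "\<lambda>l. exp (l * \<delta>) - (m * exp (l * (\<sigma> * (1 - m))) + (1 - m) * exp (l * (\<sigma> * (0 - m))))"
  have "(?f has_real_derivative \<delta>) (at 0)"
    by (auto intro!: derivative_eq_intros simp: algebra_simps)
  from DERIV_pos_inc_right[OF this assms] obtain d where
    d: "d > 0" "\<And>h. 0 < h \<Longrightarrow> h < d \<Longrightarrow> ?f 0 < ?f (0 + h)" by auto
  from d(2)[of "d / 2"] d(1) show ?thesis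
    by (intro exI[of _ "d / 2"]) (simp add: algebra_simps)
qed

text \<open>The number of rounds since the last pull of \<open>a\<close>; the full length of
  \<open>h\<close> if \<open>a\<close> does not occur.\<close>

definition gap :: "arm \<Rightarrow> history \<Rightarrow> nat" where
  "gap a h = length (takeWhile (\<lambda>x. fst x \<noteq> a) (rev h))"

lemma gap_snoc: "gap a (h @ [(b, r)]) = (if b = a then 0 else Suc (gap a h))"
  by (simp add: gap_def)

context bandit_process
begin

text \<open>The potential is an exponential supermartingale for the centred rewards of arm \<open>a\<close>, with a
  slightly too large compensator: it decreases by a fixed factor at every pull of \<open>a\<close>.\<close>

lemma eventually_deviation_less:
  fixes \<sigma> \<delta> :: real
  assumes "0 \<le> \<mu> a" "\<mu> a \<le> 1" "\<delta> > 0"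
  shows "AE \<omega> in M. \<forall>\<^sub>F t in sequentially. A t \<omega> = a \<longrightarrow>
    \<sigma> * deviation \<mu> a (hist A R t \<omega>) < \<delta> * real (num_pulls a (hist A R t \<omega>))"
proof -
  obtain l where l: "l > 0" and
    less: "\<mu> a * exp (l * (\<sigma> * (1 - \<mu> a))) + (1 - \<mu> a) * exp (l * (\<sigma> * (0 - \<mu> a))) < exp (l * \<delta>)"
    using exp_moment_less[OF assms(3)] by blast
  define E where "E = exp (l * \<delta>)"
  define e where "e r = exp (l * (\<sigma> * (of_bool r - \<mu> a)))" for r
  define \<phi> where "\<phi> = (\<Sum>r\<in>UNIV. pmf (bernoulli_pmf (\<mu> a)) r * e r)"
  \<comment> \<open>A pull of \<open>a\<close> multiplies \<open>Y\<close> by a factor of mean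
    \<open>\<phi> / E = 1 - \<theta>\<close>. The potential \<open>Y / \<theta>\<close> therefore
    loses \<open>Y\<close> in expectation at each pull of \<open>a\<close>.\<close>
  define \<theta> where "\<theta> = 1 - \<phi> / E"
  define Y where "Y h = exp (l * (\<sigma> * deviation \<mu> a h - \<delta> * real (num_pulls a h)))" for h
  \<comment> \<open>The last round pulled \<open>a\<close> although the history before it already
    had \<open>1 \<le> Y\<close>; this is why the indicator is at most \<open>Y\<close> at that
    earlier history.\<close>
  define S where "S = {h. h \<noteq> [] \<and> fst (last h) = a \<and> 1 \<le> Y (butlast h)}"
  have "\<phi> < E"
    using less assms by (simp add: \<phi>_def e_def E_def UNIV_bool)
  moreover have E: "E > 0" by (simp add: E_def)
  ultimately have \<theta>: "\<theta> > 0" by (simp add: \<theta>_def)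
  have Y_snoc: "Y (h @ [(b, r)]) = (if b = a then Y h * e r / E else Y h)" for h b r
    unfolding Y_def e_def E_def num_pulls_snoc deviation_snoc
    by (simp add: algebra_simps flip: exp_add exp_diff)
  have "AE \<omega> in M. \<forall>\<^sub>F t in sequentially. hist A R (Suc t) \<omega> \<notin> S"
  proof (rule eventually_hist_notin)
    show "0 \<le> Y h / \<theta>" for h
      using \<theta> by (simp add: Y_def)
    fix h
    \<comment> \<open>The increment of \<open>Y / \<theta>\<close> at a pull with reward
      \<open>r\<close>, plus \<open>Y h\<close> to pay for the indicator; its mean is 0.\<close>
    let ?k = "\<lambda>r. Y h / \<theta> / E * e r + Y h * (1 - 1 / \<theta>)"
    have "expected_next \<mu> \<pi> (\<lambda>h. Y h / \<theta> + indicator S h) h \<le> Y h / \<theta> + pmf (\<pi> h) a * 0"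
    proof (rule expected_next_le)
      fix b r
      have "indicator S (h @ [(a, r)]) \<le> Y h"
        by (simp add: S_def indicator_def Y_def)
      then show "Y (h @ [(b, r)]) / \<theta> + indicator S (h @ [(b, r)]) \<le>
          Y h / \<theta> + (if b = a then ?k r else 0)"
        by (simp add: Y_snoc algebra_simps) (simp add: S_def)
    next
      have "(\<Sum>r\<in>UNIV. pmf (bernoulli_pmf (\<mu> a)) r * ?k r) =
          Y h / \<theta> / E * \<phi> + Y h * (1 - 1 / \<theta>) * (\<Sum>r\<in>UNIV. pmf (bernoulli_pmf (\<mu> a)) r)"
        unfolding \<phi>_def sum_distrib_left sum.distrib[symmetric] by (simp add: algebra_simps)
      also have "\<dots> = Y h / \<theta> * (\<phi> / E + (\<theta> - 1))"
        using \<theta> by (simp add: sum_pmf_bool field_simps)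
      finally show "(\<Sum>r\<in>UNIV. pmf (bernoulli_pmf (\<mu> a)) r * ?k r) \<le> 0"
        by (simp add: \<theta>_def)
    qed
    then show "expected_next \<mu> \<pi> (\<lambda>h. Y h / \<theta> + indicator S h) h \<le> Y h / \<theta>" by simp
  qed
  then show ?thesis
  proof eventually_elim
    case (elim \<omega>)
    with eventually_ge_at_top[of 1] show ?case
    proof eventually_elim
      case (elim t)
      then have "A t \<omega> = a \<Longrightarrow> Y (hist A R t \<omega>) < 1"
        using hist_Suc[of t A R \<omega>] by (simp add: S_def)
      then show ?case
        using l by (auto simp: Y_def mult_less_0_iff)
    qed
  qed
qed

text \<open>The potential bounds the expected length of the rest of a run without \<open>a\<close> that started
  at round \<open>s + 1\<close>.\<close>

lemma not_eventually_avoided_likely: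
  assumes "0 < \<epsilon>" "\<epsilon> \<le> 1"
  shows "AE \<omega> in M. \<not> (\<forall>\<^sub>F t in sequentially. A t \<omega> \<noteq> a \<and> \<epsilon> \<le> pmf (\<pi> (hist A R t \<omega>)) a)"
proof -
  have inv: "1 \<le> 1 / \<epsilon>"
    using assms by simp
  define S where "S s = {h :: history. \<forall>i\<in>{s..<length h}. fst (h ! i) \<noteq> a \<and> \<epsilon> \<le> pmf (\<pi> (take i h)) a}" for s
  have S_snoc: "h @ [(b, r)] \<in> S s \<longleftrightarrow>
      h \<in> S s \<and> (s \<le> length h \<longrightarrow> b \<noteq> a \<and> \<epsilon> \<le> pmf (\<pi> h) a)" for h b r s
    by (cases "s \<le> length h") (auto simp: S_def atLeastLessThanSuc nth_append)
  have "AE \<omega> in M. \<forall>\<^sub>F t in sequentially. hist A R (Suc t) \<omega> \<notin> S s" for s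
  proof (rule eventually_hist_notin)
    \<comment> \<open>Up to length \<open>s\<close> the condition in \<open>S s\<close> is vacuous,
      which gives \<open>s - length h\<close> certain visits (truncated at 0). Afterwards each visit
      survives with probability at most \<open>1 - \<epsilon>\<close>, and
      \<open>1 / \<epsilon> - 1\<close> is the sum of that geometric series.\<close>
    let ?V = "\<lambda>h. if h \<in> S s then real (s - length h) + 1 / \<epsilon> - 1 else 0"
    show V_nonneg: "0 \<le> ?V h" for h
      using inv by (simp add: add_increasing)
    fix h
    let ?W = "\<lambda>h. ?V h + indicator (S s) h"
    consider "h \<notin> S s" | "h \<in> S s" "length h < s" | "h \<in> S s" "s \<le> length h" "\<epsilon> \<le> pmf (\<pi> h) a"
      | "h \<in> S s" "s \<le> length h" "pmf (\<pi> h) a < \<epsilon>"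
      by linarith
    then show "expected_next \<mu> \<pi> ?W h \<le> ?V h"
    proof cases
      case 1
      have "expected_next \<mu> \<pi> ?W h \<le> 0 + pmf (\<pi> h) a * 0"
        by (rule expected_next_le[where k = "\<lambda>_. 0"]) (use 1 in \<open>auto simp: S_snoc\<close>)
      then show ?thesis using 1 by simp
    next
      case 2
      have "expected_next \<mu> \<pi> ?W h \<le> ?V h + pmf (\<pi> h) a * 0"
        by (rule expected_next_le[where k = "\<lambda>_. 0"]) (use 2 in \<open>auto simp: S_snoc of_nat_diff\<close>)
      then show ?thesis by simp
    next
      case 3
      have "expected_next \<mu> \<pi> ?W h \<le> 1 / \<epsilon> + pmf (\<pi> h) a * (- (1 / \<epsilon>))"
      proof (rule expected_next_le)
        show "?W (h @ [(b, r)]) \<le> 1 / \<epsilon> + (if b = a then - (1 / \<epsilon>) else 0)" for b r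
          using 3 by (auto simp: S_snoc)
      qed (simp only: sum_pmf_bool_mult order_refl)
      also have "\<dots> \<le> 1 / \<epsilon> - 1"
        using 3 assms by (simp add: field_simps)
      finally show ?thesis using 3 by simp
    next
      case 4
      have "expected_next \<mu> \<pi> ?W h \<le> 0 + pmf (\<pi> h) a * 0"
        by (rule expected_next_le[where k = "\<lambda>_. 0"]) (use 4 in \<open>auto simp: S_snoc\<close>)
      then show ?thesis
        using V_nonneg[of h] by linarith
    qed
  qed
  then have "AE \<omega> in M. \<forall>s. \<forall>\<^sub>F t in sequentially. hist A R (Suc t) \<omega> \<notin> S s"
    by (simp add: AE_all_countable)
  then show ?thesis
  proof eventually_elim
    case (elim \<omega>)
    show ?case
    proof
      assume "\<forall>\<^sub>F t in sequentially. A t \<omega> \<noteq> a \<and> \<epsilon> \<le> pmf (\<pi> (hist A R t \<omega>)) a"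
      then obtain s where s: "\<And>t. t \<ge> s \<Longrightarrow> A t \<omega> \<noteq> a \<and> \<epsilon> \<le> pmf (\<pi> (hist A R t \<omega>)) a"
        by (auto simp: eventually_sequentially)
      have "hist A R (Suc t) \<omega> \<in> S s" for t
        unfolding S_def
      proof (intro CollectI ballI)
        fix i
        assume i: "i \<in> {s..<length (hist A R (Suc t) \<omega>)}"
        \<comment> \<open>Entry \<open>i\<close> of the history, counted from 0, belongs to round
          \<open>Suc i\<close>.\<close>
        then have "i < t" "s \<le> Suc i" by (auto simp: length_hist)
        then have "fst (hist A R (Suc t) \<omega> ! i) = A (Suc i) \<omega>"
          and "take i (hist A R (Suc t) \<omega>) = hist A R (Suc i) \<omega>"
          by (simp_all add: hist_def take_map del: upt_Suc)
        with s[OF \<open>s \<le> Suc i\<close>] show "fst (hist A R (Suc t) \<omega> ! i) \<noteq> a \<and>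
            \<epsilon> \<le> pmf (\<pi> (take i (hist A R (Suc t) \<omega>))) a"
          by simp
      qed
      then show False
        using elim[rule_format, of s] by simp
    qed
  qed
qed

text \<open>The potential charges \<open>exp (- c N)\<close>, with \<open>N\<close> the number of pulls of \<open>a\<close>, to each of the \<open>T\<close> rounds
  that follow a pull of \<open>a\<close>; over all pulls the charges sum to a geometric series.\<close>

lemma eventually_no_pull_after_recent:
  assumes "c > 0" and unlikely: "\<And>h. h \<in> G \<Longrightarrow> pmf (\<pi> h) a \<le> exp (- c * real (num_pulls a h))"
  shows "AE \<omega> in M. \<forall>\<^sub>F t in sequentially.
    hist A R t \<omega> \<in> G \<and> gap a (hist A R t \<omega>) < T \<longrightarrow> A t \<omega> \<noteq> a"
proof -
  \<comment> \<open>The sum of the series with terms \<open>(T + 1) * exp (- c * k)\<close>. With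
    this \<open>C\<close>, a pull of \<open>a\<close> does not raise the potential: the factor
    \<open>exp (- c)\<close> outweighs the new window of \<open>T\<close> rounds.\<close>
  define C where "C = (real T + 1) / (1 - exp (- c))"
  define e where "e h = exp (- c * real (num_pulls a h))" for h
  define S where "S = {h. h \<noteq> [] \<and> fst (last h) = a \<and> butlast h \<in> G \<and> gap a (butlast h) < T}"
  have c: "exp (- c) < 1" using assms by simp
  then have "C > 0" by (simp add: C_def)
  have "C * (1 - exp (- c)) = real T + 1"
    using c by (simp add: C_def)
  moreover have "real T * exp (- c) \<le> real T * 1"
    using c by (intro mult_left_mono) auto
  ultimately have C: "exp (- c) * (C + real T) \<le> C - 1"
    by (simp add: algebra_simps)
  have e_pos: "e h > 0" for h by (simp add: e_def)
  have e_snoc: "e (h @ [(b, r)]) = (if b = a then e h * exp (- c) else e h)" for h b r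
    by (simp add: e_def num_pulls_snoc algebra_simps flip: exp_add)
  have "AE \<omega> in M. \<forall>\<^sub>F t in sequentially. hist A R (Suc t) \<omega> \<notin> S"
  proof (rule eventually_hist_notin)
    let ?V = "\<lambda>h. e h * (C + real (T - gap a h))"
    show "0 \<le> ?V h" for h
      using \<open>C > 0\<close> e_pos[of h] by simp
    fix h
    let ?P = "h \<in> G \<and> gap a h < T"
    \<comment> \<open>The potential after a round without \<open>a\<close>. Within the window it has
      dropped by exactly \<open>e h\<close>, which pays for the probability of a pull when
      \<open>h \<in> G\<close>; in all other cases nothing is charged.\<close>
    let ?y = "e h * (C + real (T - Suc (gap a h)))"
    have "e h * (exp (- c) * (C + real T)) \<le> e h * (C + real (T - Suc (gap a h)))"
      using C e_pos[of h] by (intro mult_left_mono) auto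
    then have "expected_next \<mu> \<pi> (\<lambda>h. ?V h + indicator S h) h \<le> ?y + pmf (\<pi> h) a * of_bool ?P"
      by (intro expected_next_le[where k = "\<lambda>_. of_bool ?P"])
        (auto simp: e_snoc gap_snoc S_def sum_pmf_bool simp flip: sum_distrib_right)
    also have "\<dots> \<le> ?V h"
    proof (cases ?P)
      case True
      then have "pmf (\<pi> h) a \<le> e h"
        using unlikely by (simp add: e_def)
      with True show ?thesis
        by (simp add: of_nat_diff algebra_simps)
    next
      case False
      have "?y \<le> ?V h"
        using e_pos[of h] by (intro mult_left_mono) auto
      moreover have "pmf (\<pi> h) a * of_bool ?P = 0"
        using False by simp
      ultimately show ?thesis by linarith
    qed
    finally show "expected_next \<mu> \<pi> (\<lambda>h. ?V h + indicator S h) h \<le> ?V h" .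
  qed
  then show ?thesis
  proof eventually_elim
    case (elim \<omega>)
    with eventually_ge_at_top[of 1] show ?case
    proof eventually_elim
      case (elim t)
      then show ?case
        using hist_Suc[of t A R \<omega>] by (auto simp: S_def)
    qed
  qed
qed

end

section \<open>Accuracy of the empirical means and infinitely many pulls\<close>

lemma filter_hist_eq:
  assumes "1 \<le> s" "s \<le> t" "\<And>i. s \<le> i \<Longrightarrow> i < t \<Longrightarrow> A i \<omega> \<noteq> a"
  shows "filter (\<lambda>x. fst x = a) (hist A R t \<omega>) = filter (\<lambda>x. fst x = a) (hist A R s \<omega>)"
  using assms(2) assms(3)
proof (induction t rule: dec_induct)
  case (step n)
  have "filter (\<lambda>x. fst x = a) (hist A R (Suc n) \<omega>) = filter (\<lambda>x. fst x = a) (hist A R n \<omega>)"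
    using assms(1) step.hyps step.prems[of n] by (subst hist_Suc) auto
  with step show ?case by simp
qed simp

lemma gap_hist_less:
  assumes "1 \<le> s" "s < t" "A s \<omega> = a"
  shows "gap a (hist A R t \<omega>) < t - s"
  using Suc_leI[OF assms(2)]
proof (induction t rule: dec_induct)
  case base
  then show ?case using assms by (subst hist_Suc) (auto simp: gap_snoc)
next
  case (step n)
  then show ?case using assms(1) by (subst hist_Suc) (auto simp: gap_snoc)
qed

text \<open>The statistics of an arm do not change until its next pull.\<close>

lemma eventually_if_at_pulls:
  assumes "\<exists>\<^sub>F t in sequentially. A t \<omega> = a"
    and "\<forall>\<^sub>F t in sequentially. A t \<omega> = a \<longrightarrow>
      P (num_pulls a (hist A R t \<omega>)) (emp_mean a (hist A R t \<omega>))"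
  shows "\<forall>\<^sub>F t in sequentially. P (num_pulls a (hist A R t \<omega>)) (emp_mean a (hist A R t \<omega>))"
proof -
  obtain N where N: "\<And>t. t \<ge> N \<Longrightarrow> A t \<omega> = a \<Longrightarrow>
      P (num_pulls a (hist A R t \<omega>)) (emp_mean a (hist A R t \<omega>))"
    using assms(2) by (auto simp: eventually_sequentially)
  show ?thesis
    using eventually_ge_at_top[of "max N 1"]
  proof eventually_elim
    case (elim t)
    \<comment> \<open>The first pull of \<open>a\<close> from \<open>t\<close> on. The property
      holds at that round and carries back to \<open>t\<close>.\<close>
    define s where "s = (LEAST s. t \<le> s \<and> A s \<omega> = a)"
    have "\<exists>s. t \<le> s \<and> A s \<omega> = a"
      using assms(1) by (auto simp: frequently_sequentially)
    then have s: "t \<le> s" "A s \<omega> = a"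
      unfolding s_def by (metis (mono_tags, lifting) LeastI)+
    have "filter (\<lambda>x. fst x = a) (hist A R s \<omega>) = filter (\<lambda>x. fst x = a) (hist A R t \<omega>)"
    proof (rule filter_hist_eq)
      fix i
      assume "t \<le> i" "i < s"
      then show "A i \<omega> \<noteq> a"
        using not_less_Least[of i "\<lambda>s. t \<le> s \<and> A s \<omega> = a"] by (auto simp: s_def)
    qed (use elim s in auto)
    with N[of s] elim s show ?case
      by (simp add: num_pulls_def emp_mean_def)
  qed
qed

text \<open>The one-sided deviation bound for both signs of \<open>\<sigma>\<close>, divided by the
  number of pulls.\<close>

lemma (in bandit_process) eventually_emp_mean_close:
  assumes "0 \<le> \<mu> a" "\<mu> a \<le> 1" "\<delta> > 0"
  shows "AE \<omega> in M. \<forall>\<^sub>F t in sequentially. A t \<omega> = a \<longrightarrow>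
    0 < num_pulls a (hist A R t \<omega>) \<and> \<bar>emp_mean a (hist A R t \<omega>) - \<mu> a\<bar> < \<delta>"
  using eventually_deviation_less[OF assms, of 1] eventually_deviation_less[OF assms, of "-1"]
proof eventually_elim
  case (elim \<omega>)
  then show ?case
  proof eventually_elim
    case (elim t)
    show ?case
    proof
      assume "A t \<omega> = a"
      define N where "N = num_pulls a (hist A R t \<omega>)"
      with elim \<open>A t \<omega> = a\<close> have less: "deviation \<mu> a (hist A R t \<omega>) < \<delta> * real N"
        "- deviation \<mu> a (hist A R t \<omega>) < \<delta> * real N"
        by auto
      \<comment> \<open>Without pulls, the two strict inequalities would make both the deviation and
        its negative less than 0.\<close>
      have "N > 0"
      proof (rule ccontr)
        assume "\<not> N > 0"
        with less show False by simp
      qed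
      then have "deviation \<mu> a (hist A R t \<omega>) = real N * (emp_mean a (hist A R t \<omega>) - \<mu> a)"
        unfolding N_def by (rule deviation_eq)
      with less have "real N * (emp_mean a (hist A R t \<omega>) - \<mu> a) < real N * \<delta>"
        "real N * (- (emp_mean a (hist A R t \<omega>) - \<mu> a)) < real N * \<delta>"
        by (simp_all only: mult_minus_right mult.commute[of \<delta>])
      with \<open>N > 0\<close> have "\<bar>emp_mean a (hist A R t \<omega>) - \<mu> a\<bar> < \<delta>"
        by (simp only: abs_less_iff mult_less_cancel_left_pos of_nat_0_less_iff)
      with \<open>N > 0\<close> show "0 < num_pulls a (hist A R t \<omega>) \<and> \<bar>emp_mean a (hist A R t \<omega>) - \<mu> a\<bar> < \<delta>"
        by (simp add: N_def)
    qed
  qed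
qed

lemma frequently_pulled_med:
  assumes "bandit_process M \<mu> (med q) A R" "\<And>b. 0 \<le> \<mu> b" "\<And>b. \<mu> b < 1"
  shows "AE \<omega> in M. \<exists>\<^sub>F t in sequentially. A t \<omega> = a"
proof -
  interpret bandit_process M \<mu> "med q" A R by fact
  obtain b where b: "b \<noteq> a" "\<And>x. x \<noteq> a \<Longrightarrow> x = b"
    using that[of Arm1] that[of Arm2] by (cases a) (metis arm.exhaust arm.distinct(1))+
  \<comment> \<open>The midpoint between \<open>\<mu> b\<close> and 1, so an error below
    \<open>(1 - \<mu> b) / 2\<close> keeps the empirical mean of \<open>b\<close> under
    \<open>c\<close>.\<close>
  define c where "c = (1 + \<mu> b) / 2"
  have c: "0 \<le> c" "c < 1"
    using assms(2,3)[of b] by (auto simp: c_def)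
  \<comment> \<open>The lower bound on the sampling probability depends on the path through the
    final number of pulls \<open>n\<close>. Countably many thresholds give one null set for all
    paths.\<close>
  have "AE \<omega> in M. \<forall>k. \<not> (\<forall>\<^sub>F t in sequentially.
      A t \<omega> \<noteq> a \<and> inverse (real (Suc k)) \<le> pmf (med q (hist A R t \<omega>)) a)"
    unfolding AE_all_countable
    by (intro allI not_eventually_avoided_likely) (auto simp: inverse_eq_divide)
  moreover have "AE \<omega> in M. \<forall>\<^sub>F t in sequentially. A t \<omega> = b \<longrightarrow>
      0 < num_pulls b (hist A R t \<omega>) \<and> \<bar>emp_mean b (hist A R t \<omega>) - \<mu> b\<bar> < (1 - \<mu> b) / 2"
    using assms(2,3)[of b] by (intro eventually_emp_mean_close) auto
  ultimately show ?thesis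
  proof eventually_elim
    case (elim \<omega>)
    show ?case
    proof (rule ccontr)
      assume "\<not> (\<exists>\<^sub>F t in sequentially. A t \<omega> = a)"
      then have never: "\<forall>\<^sub>F t in sequentially. A t \<omega> \<noteq> a"
        by (simp add: frequently_def)
      then obtain s where s: "\<And>t. t \<ge> s \<Longrightarrow> A t \<omega> \<noteq> a"
        by (auto simp: eventually_sequentially)
      define n where "n = num_pulls a (hist A R (max s 1) \<omega>)"
      have n: "num_pulls a (hist A R t \<omega>) = n" if "t \<ge> max s 1" for t
        unfolding n_def num_pulls_def using that s by (subst filter_hist_eq[of "max s 1" t]) auto
      have "(1 - c) ^ n / 2 > 0"
        using c by simp
      then obtain k where k: "inverse (real (Suc k)) < (1 - c) ^ n / 2"
        using reals_Archimedean by blast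
      have "\<forall>\<^sub>F t in sequentially. (1 - c) ^ n / 2 \<le> pmf (med q (hist A R t \<omega>)) a"
        using elim(2) eventually_ge_at_top[of "max s 2"]
      proof eventually_elim
        case (elim t)
        then have "A t \<omega> = b" by (intro b(2) s) simp
        with elim have bt: "0 < num_pulls b (hist A R t \<omega>)"
          and less: "\<bar>emp_mean b (hist A R t \<omega>) - \<mu> b\<bar> < (1 - \<mu> b) / 2"
          by simp_all
        have mean: "emp_mean b (hist A R t \<omega>) \<le> c"
          using le_less_trans[OF abs_ge_self less] by (simp add: c_def field_simps)
        have nt: "num_pulls a (hist A R t \<omega>) = n"
          using n elim by auto
        show ?case
        \<comment> \<open>If \<open>a\<close> was never pulled, the weights do not apply, but the
          initial phase of MED pulls \<open>a\<close> with certainty.\<close>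
        proof (cases "n = 0")
          case True
          have "hist A R t \<omega> \<noteq> []"
            using bt by (auto simp: num_pulls_def)
          then show ?thesis
            using nt True by (simp add: pmf_med_unpulled)
        next
          case False
          have "0 < num_pulls x (hist A R t \<omega>)" for x
            using bt nt False b(2)[of x] by (cases "x = a") auto
          moreover have "emp_mean x (hist A R t \<omega>) \<le> c" if "x \<noteq> a" for x
            using mean b(2)[OF that] by simp
          ultimately show ?thesis
            using pmf_med_ge[OF _ _ c(2,1), of "hist A R t \<omega>" a q] nt by simp
        qed
      qed
      with never have "\<forall>\<^sub>F t in sequentially.
          A t \<omega> \<noteq> a \<and> inverse (real (Suc k)) \<le> pmf (med q (hist A R t \<omega>)) a"
        by eventually_elim (use k in auto)
      with elim(1) show False by blast
    qed
  qed
qed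

section \<open>Sliding regret from the spacing of the pulls of arm 2\<close>

lemma limsup_eqI:
  fixes f :: "nat \<Rightarrow> ereal"
  assumes "\<forall>\<^sub>F t in sequentially. f t \<le> c" "\<exists>\<^sub>F t in sequentially. f t = c"
  shows "limsup f = c"
proof (rule antisym)
  show "limsup f \<le> c"
    using assms(1) by (rule Limsup_bounded)
  show "c \<le> limsup f"
  proof (rule ccontr)
    assume "\<not> c \<le> limsup f"
    then have "\<forall>\<^sub>F t in sequentially. f t < c"
      by (intro Limsup_lessD) auto
    then have "\<forall>\<^sub>F t in sequentially. f t \<noteq> c"
      by eventually_elim auto
    with assms(2) show False by (simp add: frequently_def)
  qed
qed

text \<open>Only pulls of arm 2 contribute to the regret, each the difference of the means, and the
  hypothesis allows at most one of them in the window.\<close>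

lemma window_regret:
  fixes \<mu> :: "arm \<Rightarrow> real"
  assumes "\<And>i j. i \<in> {1..T} \<Longrightarrow> j \<in> {1..T} \<Longrightarrow> i < j \<Longrightarrow> A (t + i) \<omega> = Arm2 \<Longrightarrow> A (t + j) \<omega> \<noteq> Arm2"
  shows "real T * \<mu> Arm1 - (\<Sum>i=1..T. \<mu> (A (t + i) \<omega>)) =
    (if \<exists>i\<in>{1..T}. A (t + i) \<omega> = Arm2 then \<mu> Arm1 - \<mu> Arm2 else 0)"
proof -
  have "real T * \<mu> Arm1 - (\<Sum>i=1..T. \<mu> (A (t + i) \<omega>)) =
      (\<Sum>i=1..T. \<mu> Arm1 - \<mu> (A (t + i) \<omega>))"
    by (simp add: sum_subtractf)
  also have "\<dots> = (if \<exists>i\<in>{1..T}. A (t + i) \<omega> = Arm2 then \<mu> Arm1 - \<mu> Arm2 else 0)"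
  proof (cases "\<exists>i\<in>{1..T}. A (t + i) \<omega> = Arm2")
    case True
    then obtain i where i: "i \<in> {1..T}" "A (t + i) \<omega> = Arm2" by blast
    have "A (t + j) \<omega> = Arm1" if "j \<in> {1..T}" "j \<noteq> i" for j
      using assms[of i j] assms[of j i] i that by (metis arm.exhaust nat_neq_iff)
    then have "(\<Sum>i=1..T. \<mu> Arm1 - \<mu> (A (t + i) \<omega>)) =
        (\<Sum>j=1..T. if j = i then \<mu> Arm1 - \<mu> Arm2 else 0)"
      using i by (intro sum.cong) auto
    with True i show ?thesis by simp
  next
    case False
    then have "A (t + i) \<omega> = Arm1" if "i \<in> {1..T}" for i
      using that by (metis arm.exhaust)
    with False show ?thesis by simp
  qed
  finally show ?thesis .
qed

theorem theorem5:
  fixes M :: "'w measure"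
    and \<mu> :: "arm \<Rightarrow> real"
    and q :: "arm pmf"
    and A :: "nat \<Rightarrow> 'w \<Rightarrow> arm"
    and R :: "nat \<Rightarrow> 'w \<Rightarrow> bool"
    and T :: nat
  assumes "0 < \<mu> Arm2" and "\<mu> Arm2 < \<mu> Arm1" and "\<mu> Arm1 < 1"
    and "bandit_process M \<mu> (med q) A R"
    and "T \<ge> 1"
  shows "AE \<omega> in M. sliding_regret \<mu> A T \<omega> = ereal (\<mu> Arm1 - \<mu> Arm2)"
proof -
  interpret bandit_process M \<mu> "med q" A R by fact
  define \<Delta> where "\<Delta> = \<mu> Arm1 - \<mu> Arm2"
  have \<Delta>: "\<Delta> > 0" using assms by (simp add: \<Delta>_def)
  have \<mu>: "0 \<le> \<mu> a" "\<mu> a < 1" for a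
    using assms by (cases a; simp)+
  \<comment> \<open>Errors below \<open>\<Delta> / 4\<close> in both empirical means leave at least
    \<open>\<Delta> / 2\<close> of the true gap.\<close>
  define G where "G = {h. (\<forall>b. 0 < num_pulls b h) \<and> \<Delta> / 2 \<le> emp_mean Arm1 h - emp_mean Arm2 h}"
  have "pmf (med q h) Arm2 \<le> exp (- ((\<Delta> / 2)\<^sup>2 / 4) * real (num_pulls Arm2 h))" if "h \<in> G" for h
    using that \<Delta> by (intro pmf_med_worse_le) (auto simp: G_def)
  then have recent: "AE \<omega> in M. \<forall>\<^sub>F t in sequentially.
      hist A R t \<omega> \<in> G \<and> gap Arm2 (hist A R t \<omega>) < T \<longrightarrow> A t \<omega> \<noteq> Arm2"
    using \<Delta> by (intro eventually_no_pull_after_recent[where c = "(\<Delta> / 2)\<^sup>2 / 4"]) auto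
  have frequently: "AE \<omega> in M. \<exists>\<^sub>F t in sequentially. A t \<omega> = a" for a
    using assms(4) \<mu> by (rule frequently_pulled_med)
  have close: "AE \<omega> in M. \<forall>\<^sub>F t in sequentially. A t \<omega> = a \<longrightarrow>
      0 < num_pulls a (hist A R t \<omega>) \<and> \<bar>emp_mean a (hist A R t \<omega>) - \<mu> a\<bar> < \<Delta> / 4" for a
    using \<mu>[of a] \<Delta> by (intro eventually_emp_mean_close) auto
  show ?thesis
    using recent frequently[of Arm1] frequently[of Arm2] close[of Arm1] close[of Arm2]
  proof eventually_elim
    case (elim \<omega>)
    let ?close = "\<lambda>a N m. 0 < N \<and> \<bar>m - \<mu> a\<bar> < \<Delta> / 4"
    have "\<forall>\<^sub>F t in sequentially. hist A R t \<omega> \<in> G"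
      using eventually_if_at_pulls[where P = "?close Arm1", OF elim(2,4)]
        eventually_if_at_pulls[where P = "?close Arm2", OF elim(3,5)]
    proof eventually_elim
      case (elim t)
      then have "\<Delta> / 2 \<le> emp_mean Arm1 (hist A R t \<omega>) - emp_mean Arm2 (hist A R t \<omega>)"
        using \<Delta>_def by linarith
      moreover have "0 < num_pulls b (hist A R t \<omega>)" for b
        using elim by (cases b) auto
      ultimately show ?case
        by (simp add: G_def)
    qed
    with elim(1) have "\<forall>\<^sub>F t in sequentially. gap Arm2 (hist A R t \<omega>) < T \<longrightarrow> A t \<omega> \<noteq> Arm2"
      by eventually_elim auto
    then obtain N where N: "\<And>t. t \<ge> N \<Longrightarrow> gap Arm2 (hist A R t \<omega>) < T \<Longrightarrow> A t \<omega> \<noteq> Arm2"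
      by (auto simp: eventually_sequentially)
    let ?r = "\<lambda>t. real T * \<mu> Arm1 - (\<Sum>i=1..T. \<mu> (A (t + i) \<omega>))"
    have r: "?r t = (if \<exists>i\<in>{1..T}. A (t + i) \<omega> = Arm2 then \<Delta> else 0)" if "t \<ge> N" for t
      unfolding \<Delta>_def
    proof (rule window_regret)
      fix i j
      assume ij: "i \<in> {1..T}" "j \<in> {1..T}" "i < j" "A (t + i) \<omega> = Arm2"
      \<comment> \<open>Two pulls in one window would make the gap before the second one less than
        \<open>j - i < T\<close>, which \<open>N\<close> rules out.\<close>
      then have "gap Arm2 (hist A R (t + j) \<omega>) < (t + j) - (t + i)"
        by (intro gap_hist_less) auto
      with ij that show "A (t + j) \<omega> \<noteq> Arm2"
        by (intro N) auto
    qed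
    show ?case
      unfolding sliding_regret_def \<Delta>_def[symmetric]
    proof (rule limsup_eqI)
      show "\<forall>\<^sub>F t in sequentially. ereal (?r t) \<le> ereal \<Delta>"
        using eventually_ge_at_top[of N] by eventually_elim (use r \<Delta> in auto)
      show "\<exists>\<^sub>F t in sequentially. ereal (?r t) = ereal \<Delta>"
        unfolding frequently_sequentially
      proof
        fix n
        \<comment> \<open>The window of \<open>t - 1\<close> begins with round \<open>t\<close>, so
          \<open>T \<ge> 1\<close> puts this pull inside it; the \<open>Suc\<close> keeps
          \<open>t - 1\<close> above both \<open>n\<close> and \<open>N\<close>.\<close>
        obtain t where t: "t \<ge> Suc (max n N)" "A t \<omega> = Arm2"
          using elim(3) unfolding frequently_sequentially by blast
        then have "\<exists>i\<in>{1..T}. A (t - 1 + i) \<omega> = Arm2"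
          using assms(5) by (intro bexI[of _ 1]) auto
        with t r[of "t - 1"] show "\<exists>t\<ge>n. ereal (?r t) = ereal \<Delta>"
          by (intro exI[of _ "t - 1"]) auto
      qed
    qed
  qed
qed

end
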